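(* For an ordered Banach space $X$ the following are equivalent: (i) The bidual wedge $X''_+$ is pointed, i.e. a cone. (ii) If two norm bounded nets $(x_j)_{j\in J}$ and $(y_j)_{j \in J}$ in $X$ satisfy $0 \le x_j \le y_j$ for all $j$ and if $y_j \to 0$ weakly, then also $x_j \to 0$ weakly.
   Context: An ordered Banach space is a real Banach space $X$ together with a norm closed cone $X_+$, i.e. a norm closed non-empty subset $X_+ \subseteq X$ with $\alpha X_+ + \beta X_+ \subseteq X_+$ for all scalars $\alpha,\beta \in [0,\infty)$ and $X_+ \cap (-X_+) = \{0\}$. The partial order is given by $x \le y$ iff $y - x \in X_+$. The dual wedge is $X'_+ := \{x' \in X' : \langle x',x\rangle \ge 0 \text{ for all } x \in X_+\}$ and the bidual wedge is $X''_+ := \{x'' \in X'' : \langle x'',x'\rangle \ge 0 \text{ for all } x' \in X'_+\}$. The bidual wedge is called pointed, or a cone, if $X''_+ \cap (-X''_+) = \{0\}$. *)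

theory Defs
  imports "HOL-Analysis.Analysis"
begin

definition pointed :: "'a::real_normed_vector set \<Rightarrow> bool" where
  "pointed W \<longleftrightarrow> W \<inter> uminus ` W = {0}"

text \<open>The cone of an ordered Banach space; the space is the whole type, of class \<open>banach\<close>.\<close>

definition ordered_banach_cone :: "'a::banach set \<Rightarrow> bool" where
  "ordered_banach_cone K \<longleftrightarrow>
     closed K \<and> K \<noteq> {} \<and>
     (\<forall>\<alpha>\<ge>0. \<forall>\<beta>\<ge>0. \<forall>x\<in>K. \<forall>y\<in>K. \<alpha> *\<^sub>R x + \<beta> *\<^sub>R y \<in> K) \<and>
     pointed K"

definition cone_le :: "'a::real_normed_vector set \<Rightarrow> 'a \<Rightarrow> 'a \<Rightarrow> bool" where
  "cone_le K x y \<longleftrightarrow> y - x \<in> K"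

definition dual_wedge :: "'a::real_normed_vector set \<Rightarrow> ('a \<Rightarrow>\<^sub>L real) set" where
  "dual_wedge W = {f. \<forall>x\<in>W. 0 \<le> blinfun_apply f x}"

definition bidual_wedge ::
    "'a::real_normed_vector set \<Rightarrow> (('a \<Rightarrow>\<^sub>L real) \<Rightarrow>\<^sub>L real) set" where
  "bidual_wedge K = dual_wedge (dual_wedge K)"

text \<open>Nets are functions on a carrier \<open>J\<close> that is directed by a preorder.\<close>

definition directed_preorder :: "'j set \<Rightarrow> ('j \<Rightarrow> 'j \<Rightarrow> bool) \<Rightarrow> bool" where
  "directed_preorder J le \<longleftrightarrow>
     J \<noteq> {} \<and>
     (\<forall>i\<in>J. le i i) \<and>
     (\<forall>i\<in>J. \<forall>j\<in>J. \<forall>k\<in>J. le i j \<longrightarrow> le j k \<longrightarrow> le i k) \<and>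
     (\<forall>i\<in>J. \<forall>j\<in>J. \<exists>k\<in>J. le i k \<and> le j k)"

text \<open>The filter generated by the tails of a directed set.\<close>

definition tail_filter :: "'j set \<Rightarrow> ('j \<Rightarrow> 'j \<Rightarrow> bool) \<Rightarrow> 'j filter" where
  "tail_filter J le = (INF i\<in>J. principal {j\<in>J. le i j})"

definition weakly_tendsto ::
    "('j \<Rightarrow> 'a::real_normed_vector) \<Rightarrow> 'a \<Rightarrow> 'j filter \<Rightarrow> bool" where
  "weakly_tendsto x z F \<longleftrightarrow>
     (\<forall>f :: 'a \<Rightarrow>\<^sub>L real. ((\<lambda>j. blinfun_apply f (x j)) \<longlongrightarrow> blinfun_apply f z) F)"

text \<open>Domination passes weak nullity down, for bounded nets whose index set lies in the type
  \<open>'j\<close>. HOL cannot quantify over all index types within a formula, so \<open>'j\<close> is a parameter.\<close>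

definition weak_null_domination :: "'j itself \<Rightarrow> 'a::real_normed_vector set \<Rightarrow> bool" where
  "weak_null_domination _ K \<longleftrightarrow>
     (\<forall>(J :: 'j set) le (x :: 'j \<Rightarrow> 'a) (y :: 'j \<Rightarrow> 'a).
        directed_preorder J le \<longrightarrow>
        bounded (x ` J) \<longrightarrow> bounded (y ` J) \<longrightarrow>
        (\<forall>j\<in>J. cone_le K 0 (x j) \<and> cone_le K (x j) (y j)) \<longrightarrow>
        weakly_tendsto y 0 (tail_filter J le) \<longrightarrow>
        weakly_tendsto x 0 (tail_filter J le))"

text \<open>A universe of indices that suffices for pairs of nets in \<open>'a\<close>: such a pair has the same
  tails in \<open>'a \<times> 'a\<close> as the net \<open>(z, A) \<mapsto> z\<close>, where \<open>A\<close> ranges over the tails of the pair,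
  \<open>z \<in> A\<close>, and the indices are preordered by reverse inclusion of the second component.\<close>

type_synonym 'a pair_net_index = "('a \<times> 'a) \<times> ('a \<times> 'a) set"

end

theory Submission
  imports Defs
begin

text \<open>Both directions work with weak-star limits, in the bidual, of bounded nets in \<open>K\<close>.

  Suppose that the bidual wedge is pointed, that \<open>0 \<le> x j \<le> y j\<close> with \<open>y\<close> weakly null, and that
  \<open>f (x j)\<close> does not tend to \<open>0\<close> for some functional \<open>f\<close>. Then \<open>\<bar>f (x j)\<bar> \<ge> e\<close> frequently, for some
  \<open>e > 0\<close>, and among these \<open>j\<close> the bounded net \<open>x\<close> has a weak-star cluster point \<open>\<phi>\<close> in the bidual
  (lemma \<open>bounded_weak_star_cluster\<close>, a form of Banach-Alaoglu). For positive \<open>g\<close> the inequalities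
  \<open>0 \<le> g (x j) \<le> g (y j)\<close> give \<open>\<phi> g = 0\<close> in the limit, so \<open>\<phi>\<close> and \<open>- \<phi>\<close> are both positive and \<open>\<phi> = 0\<close>;
  yet \<open>\<bar>\<phi> f\<bar> \<ge> e\<close>.

  Conversely, suppose that \<open>\<phi>\<close> and \<open>- \<phi>\<close> are both positive. Every positive element \<open>\<psi>\<close> of the bidual
  is a weak-star limit of elements of \<open>K\<close> of norm at most \<open>norm \<psi>\<close>
  (lemma \<open>bidual_wedge_approximation\<close>). Hence there are bounded nets \<open>x\<close> and \<open>z\<close> in \<open>K\<close> that converge
  to \<open>\<phi>\<close> and \<open>- \<phi>\<close>. Their sum \<open>y\<close> is weakly null and dominates \<open>x\<close>, so \<open>x\<close> is weakly null by
  assumption, that is, \<open>\<phi> = 0\<close>.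

  The approximation result is a version of Goldstine's theorem for cones. If it fails at \<open>\<psi>\<close> for
  finitely many functionals, then separation in finite dimensions yields a functional \<open>h\<close> and a
  number \<open>\<alpha> < \<psi> h\<close> with \<open>h x \<le> \<alpha> / norm \<psi> * norm x\<close> for all \<open>x\<close> in \<open>K\<close>. A Hahn-Banach argument
  (lemma \<open>dominated_on_cone_extension\<close>) replaces \<open>h\<close> by a larger functional \<open>g\<close>, with respect to the
  dual wedge, of norm at most \<open>\<alpha> / norm \<psi>\<close>. Then \<open>\<psi> h \<le> \<psi> g \<le> \<alpha>\<close>, a contradiction.\<close>

section \<open>Sublinear functionals and dominated extension\<close>

text \<open>Subadditive and positively homogeneous functionals. Only one inequality of homogeneity is
  required; equality follows, see \<open>sublinear_scaleR\<close>.\<close>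

definition sublinear :: "('a::real_vector \<Rightarrow> real) \<Rightarrow> bool" where
  "sublinear p \<longleftrightarrow>
     (\<forall>x y. p (x + y) \<le> p x + p y) \<and> (\<forall>c\<ge>0. \<forall>x. p (c *\<^sub>R x) \<le> c * p x)"

lemma sublinear_add: "sublinear p \<Longrightarrow> p (x + y) \<le> p x + p y"
  by (simp add: sublinear_def)

lemma sublinear_zero:
  assumes "sublinear p"
  shows "p 0 = 0"
proof -
  have "p (0 *\<^sub>R 0) \<le> 0 * p 0"
    using assms by (metis order_refl sublinear_def)
  moreover have "p (0 + 0) \<le> p 0 + p 0"
    using assms by (rule sublinear_add)
  ultimately show ?thesis by simp
qed

lemma sublinear_scaleR:
  assumes "sublinear p" and "c \<ge> 0"
  shows "p (c *\<^sub>R x) = c * p x"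
proof (cases "c = 0")
  case True
  then show ?thesis using sublinear_zero[OF assms(1)] by simp
next
  case False
  with assms have c: "c > 0" by simp
  have "p (inverse c *\<^sub>R c *\<^sub>R x) \<le> inverse c * p (c *\<^sub>R x)"
    using assms c unfolding sublinear_def by (metis inverse_nonnegative_iff_nonnegative)
  then have "c * p x \<le> p (c *\<^sub>R x)"
    using c by (simp add: field_simps)
  moreover have "p (c *\<^sub>R x) \<le> c * p x"
    using assms by (simp add: sublinear_def)
  ultimately show ?thesis by simp
qed

lemma sublinear_ge_minus: "sublinear p \<Longrightarrow> - p (- x) \<le> p x"
  using sublinear_add[of p x "- x"] sublinear_zero[of p] by simp

text \<open>The two defining inequalities are only required across the family, with a third member \<open>k\<close> on
  the left; its members need not be sublinear one by one. This covers infima of chains as well as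
  infimal convolutions.\<close>

lemma sublinear_INF:
  fixes q :: "'i \<Rightarrow> 'a::real_vector \<Rightarrow> real"
  assumes ne: "I \<noteq> {}"
    and bdd: "\<And>x. bdd_below ((\<lambda>i. q i x) ` I)"
    and add: "\<And>i j x y. i \<in> I \<Longrightarrow> j \<in> I \<Longrightarrow> \<exists>k\<in>I. q k (x + y) \<le> q i x + q j y"
    and scale: "\<And>i c x. i \<in> I \<Longrightarrow> c \<ge> 0 \<Longrightarrow> \<exists>k\<in>I. q k (c *\<^sub>R x) \<le> c * q i x"
  shows "sublinear (\<lambda>x. INF i\<in>I. q i x)"
  unfolding sublinear_def
proof (intro conjI allI impI)
  fix x y
  have *: "(INF k\<in>I. q k (x + y)) - q j y \<le> (INF i\<in>I. q i x)" if j: "j \<in> I" for j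
  proof (rule cINF_greatest[OF ne])
    fix i assume "i \<in> I"
    then obtain k where "k \<in> I" "q k (x + y) \<le> q i x + q j y" using add j by blast
    moreover have "(INF k\<in>I. q k (x + y)) \<le> q k (x + y)"
      using bdd \<open>k \<in> I\<close> by (rule cINF_lower)
    ultimately show "(INF k\<in>I. q k (x + y)) - q j y \<le> q i x" by linarith
  qed
  have "(INF k\<in>I. q k (x + y)) - (INF i\<in>I. q i x) \<le> (INF j\<in>I. q j y)"
    by (rule cINF_greatest[OF ne]) (use * in \<open>force simp: algebra_simps\<close>)
  then show "(INF k\<in>I. q k (x + y)) \<le> (INF i\<in>I. q i x) + (INF i\<in>I. q i y)" by linarith
next
  fix c :: real and x assume c: "c \<ge> 0"
  have *: "(INF k\<in>I. q k (c *\<^sub>R x)) \<le> c * q i x" if i: "i \<in> I" for i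
  proof -
    obtain k where "k \<in> I" "q k (c *\<^sub>R x) \<le> c * q i x" using scale[OF i c] by blast
    then show ?thesis using cINF_lower[OF bdd \<open>k \<in> I\<close>, of "c *\<^sub>R x"] by linarith
  qed
  show "(INF k\<in>I. q k (c *\<^sub>R x)) \<le> c * (INF i\<in>I. q i x)"
  proof (cases "c = 0")
    case True
    then show ?thesis using * ne by auto
  next
    case False
    with c have "c > 0" by simp
    then have "(INF k\<in>I. q k (c *\<^sub>R x)) / c \<le> (INF i\<in>I. q i x)"
      by (intro cINF_greatest[OF ne]) (use * in \<open>simp add: field_simps\<close>)
    with \<open>c > 0\<close> show ?thesis by (simp add: field_simps)
  qed
qed

text \<open>Minimality among the sublinear functionals forces linearity, which turns the Hahn-Banach theorem
  into a direct application of Zorn's lemma.\<close>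

lemma minimal_sublinear_linear:
  fixes q :: "'a::real_vector \<Rightarrow> real"
  assumes q: "sublinear q"
    and minimal: "\<And>r. sublinear r \<Longrightarrow> (\<And>x. r x \<le> q x) \<Longrightarrow> r = q"
  shows "linear q"
proof -
  have ge: "q z + q y \<le> q (z + y)" for y z
  proof -
    \<comment> \<open>Pushing \<open>q\<close> down as far as linearity along \<open>y\<close> requires; minimality says that nothing
      changes.\<close>
    define r where "r = (\<lambda>z. INF t\<in>{0..}. q (z + t *\<^sub>R y) - t * q y)"
    have bdd: "bdd_below ((\<lambda>t. q (z + t *\<^sub>R y) - t * q y) ` {0..})" for z
    proof (rule bdd_belowI2)
      fix t :: real assume "t \<in> {0..}"
      then show "- q (- z) \<le> q (z + t *\<^sub>R y) - t * q y"
        using sublinear_add[OF q, of "z + t *\<^sub>R y" "- z"] sublinear_scaleR[OF q, of t y] by simp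
    qed
    have "sublinear r"
      unfolding r_def
    proof (rule sublinear_INF)
      fix s t :: real and x z
      assume "s \<in> {0..}" "t \<in> {0..}"
      then show "\<exists>k\<in>{0..}. q (x + z + k *\<^sub>R y) - k * q y
          \<le> q (x + s *\<^sub>R y) - s * q y + (q (z + t *\<^sub>R y) - t * q y)"
        using sublinear_add[OF q, of "x + s *\<^sub>R y" "z + t *\<^sub>R y"]
        by (intro bexI[of _ "s + t"]) (auto simp: algebra_simps)
    next
      fix t c :: real and z
      assume "t \<in> {0..}" "0 \<le> c"
      then show "\<exists>k\<in>{0..}. q (c *\<^sub>R z + k *\<^sub>R y) - k * q y \<le> c * (q (z + t *\<^sub>R y) - t * q y)"
        using sublinear_scaleR[OF q, of c "z + t *\<^sub>R y"]
        by (intro bexI[of _ "c * t"]) (auto simp: algebra_simps)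
    qed (use bdd in auto)
    moreover have le: "r z \<le> q (z + t *\<^sub>R y) - t * q y" if "t \<ge> 0" for z t
      unfolding r_def using that by (intro cINF_lower[OF bdd]) auto
    ultimately have "r = q"
      using le[of 0] by (intro minimal) auto
    then show ?thesis using le[of 1 z] by simp
  qed
  have add: "q (x + y) = q x + q y" for x y
    using ge[of x y] sublinear_add[OF q, of x y] by simp
  have minus: "q (- x) = - q x" for x
    using add[of x "- x"] sublinear_zero[OF q] by simp
  show ?thesis
  proof (rule linearI)
    fix c x
    show "q (c *\<^sub>R x) = c *\<^sub>R q x"
    proof (cases "c \<ge> 0")
      case True
      then show ?thesis using sublinear_scaleR[OF q] by simp
    next
      case False
      then show ?thesis
        using sublinear_scaleR[OF q, of "- c" x] minus[of "c *\<^sub>R x"] by simp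
    qed
  qed (rule add)
qed

text \<open>The Hahn-Banach theorem without a given functional on a subspace: that information can be
  built into \<open>p\<close>.\<close>

lemma sublinear_dominates_linear:
  fixes p :: "'a::real_vector \<Rightarrow> real"
  assumes p: "sublinear p"
  obtains g where "linear g" "\<And>x. g x \<le> p x"
proof -
  define A where "A = {q. sublinear q \<and> q \<le> p}"
  define P where "P = (\<lambda>q r :: 'a \<Rightarrow> real. r \<le> q)"
  have "\<exists>m\<in>A. \<forall>a\<in>A. P m a \<longrightarrow> a = m"
  proof (rule predicate_Zorn)
    show "partial_order_on A (relation_of P A)"
      by (rule partial_order_on_relation_ofI) (auto simp: P_def)
  next
    fix C assume C: "C \<in> Chains (relation_of P A)"
    have CA: "q \<in> A" if "q \<in> C" for q
      using C that by (auto simp: Chains_def relation_of_def)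
    have total: "q \<le> r \<or> r \<le> q" if "q \<in> C" "r \<in> C" for q r
      using C that by (auto simp: Chains_def relation_of_def P_def)
    show "\<exists>u\<in>A. \<forall>a\<in>C. P a u"
    proof (cases "C = {}")
      case True
      with p show ?thesis by (auto simp: A_def)
    next
      case False
      define u where "u = (\<lambda>x. INF q\<in>C. q x)"
      have bdd: "bdd_below ((\<lambda>q. q x) ` C)" for x
      proof (rule bdd_belowI2)
        fix q assume "q \<in> C"
        then have "sublinear q" "q (- x) \<le> p (- x)" using CA by (auto simp: A_def le_fun_def)
        then show "- p (- x) \<le> q x" using sublinear_ge_minus[of q x] by linarith
      qed
      have u_le: "u \<le> q" if "q \<in> C" for q
        unfolding u_def using that by (auto simp: le_fun_def intro: cINF_lower[OF bdd])
      have "sublinear u"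
        unfolding u_def
      proof (rule sublinear_INF)
        fix q r x y assume qr: "q \<in> C" "r \<in> C"
        have sub: "sublinear q" "sublinear r" using CA qr by (auto simp: A_def)
        from total[OF qr] show "\<exists>k\<in>C. k (x + y) \<le> q x + r y"
        proof
          assume "q \<le> r"
          then have "q (x + y) \<le> q x + r y"
            using sublinear_add[OF sub(1), of x y] le_funD[of q r y] by linarith
          with qr show ?thesis by blast
        next
          assume "r \<le> q"
          then have "r (x + y) \<le> q x + r y"
            using sublinear_add[OF sub(2), of x y] le_funD[of r q x] by linarith
          with qr show ?thesis by blast
        qed
      next
        fix q x and c :: real assume "q \<in> C" "0 \<le> c"
        then show "\<exists>k\<in>C. k (c *\<^sub>R x) \<le> c * q x"
          using CA sublinear_scaleR[of q c x] by (intro bexI[of _ q]) (auto simp: A_def)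
      qed (use False bdd in auto)
      moreover obtain q where "q \<in> C" using False by blast
      then have "u \<le> p" using u_le CA[of q] by (auto simp: A_def intro: order_trans)
      ultimately show ?thesis using u_le by (auto simp: A_def P_def)
    qed
  qed
  then obtain m where m: "sublinear m" "m \<le> p"
    and min: "\<And>a. sublinear a \<Longrightarrow> a \<le> p \<Longrightarrow> a \<le> m \<Longrightarrow> a = m"
    by (auto simp: A_def P_def)
  have "linear m"
    using m by (intro minimal_sublinear_linear min) (auto simp: le_fun_def intro: order_trans)
  with m that show ?thesis by (auto simp: le_fun_def)
qed

text \<open>A functional bounded by \<open>b * norm\<close> on the cone lies, on the cone, below a functional of norm
  at most \<open>b\<close>. The functional sought is one dominated by the infimal convolution \<open>p\<close> below: taking
  \<open>x = 0\<close> in the infimum bounds the norm, and evaluating at \<open>- x\<close> gives domination of \<open>h\<close>.\<close>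

lemma dominated_on_cone_extension:
  fixes K :: "'a::real_normed_vector set" and h :: "'a \<Rightarrow>\<^sub>L real"
  assumes K0: "0 \<in> K"
    and Kadd: "\<And>x y. x \<in> K \<Longrightarrow> y \<in> K \<Longrightarrow> x + y \<in> K"
    and Kscale: "\<And>x c. x \<in> K \<Longrightarrow> c \<ge> 0 \<Longrightarrow> c *\<^sub>R x \<in> K"
    and b: "0 \<le> b" and h: "\<And>x. x \<in> K \<Longrightarrow> h x \<le> b * norm x"
  obtains g :: "'a \<Rightarrow>\<^sub>L real" where "norm g \<le> b" "\<And>x. x \<in> K \<Longrightarrow> h x \<le> g x"
proof -
  define p where "p = (\<lambda>z. INF x\<in>K. b * norm (z + x) - h x)"
  have bdd: "bdd_below ((\<lambda>x. b * norm (z + x) - h x) ` K)" for z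
  proof (rule bdd_belowI2)
    fix x assume "x \<in> K"
    have "norm x \<le> norm (z + x) + norm z"
      using norm_triangle_ineq4[of "z + x" z] by simp
    then have "b * norm x \<le> b * norm (z + x) + b * norm z"
      using b by (metis distrib_left mult_left_mono)
    then show "- (b * norm z) \<le> b * norm (z + x) - h x"
      using h[OF \<open>x \<in> K\<close>] by linarith
  qed
  have "sublinear p"
    unfolding p_def
  proof (rule sublinear_INF)
    fix i j x y assume ij: "i \<in> K" "j \<in> K"
    have "norm (x + y + (i + j)) \<le> norm (x + i) + norm (y + j)"
      using norm_triangle_ineq[of "x + i" "y + j"] by (simp add: algebra_simps)
    then have "b * norm (x + y + (i + j)) \<le> b * norm (x + i) + b * norm (y + j)"
      using b by (metis distrib_left mult_left_mono)
    then show "\<exists>k\<in>K. b * norm (x + y + k) - h k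
        \<le> b * norm (x + i) - h i + (b * norm (y + j) - h j)"
      using ij Kadd by (intro bexI[of _ "i + j"]) (auto simp: blinfun.add_right)
  next
    fix i x and c :: real assume ic: "i \<in> K" "0 \<le> c"
    have "norm (c *\<^sub>R x + c *\<^sub>R i) = c * norm (x + i)"
      using ic by (metis norm_scaleR scaleR_add_right abs_of_nonneg)
    then show "\<exists>k\<in>K. b * norm (c *\<^sub>R x + k) - h k \<le> c * (b * norm (x + i) - h i)"
      using ic Kscale by (intro bexI[of _ "c *\<^sub>R i"]) (auto simp: blinfun.scaleR_right algebra_simps)
  qed (use K0 bdd in auto)
  then obtain l where l: "linear l" "\<And>z. l z \<le> p z"
    using sublinear_dominates_linear by blast
  have le: "l z \<le> b * norm (z + x) - h x" if "x \<in> K" for x z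
    using l(2)[of z] cINF_lower[OF bdd that, of z] by (simp add: p_def)
  have upper: "l z \<le> b * norm z" for z using le[OF K0, of z] by (simp add: blinfun.zero_right)
  have bound: "norm (l z) \<le> b * norm z" for z
    using upper[of z] upper[of "- z"] linear_neg[OF l(1), of z] by (simp add: abs_le_iff)
  have "bounded_linear l"
    using l(1) bound unfolding bounded_linear_def bounded_linear_axioms_def
    by (metis mult.commute)
  then have app: "blinfun_apply (Blinfun l) = l" by (rule bounded_linear_Blinfun_apply)
  show ?thesis
  proof
    show "norm (Blinfun l) \<le> b" using b bound by (intro norm_blinfun_bound) (simp_all add: app)
    show "h x \<le> Blinfun l x" if "x \<in> K" for x
      using le[OF that, of "- x"] linear_neg[OF l(1), of x] by (simp add: app)
  qed
qed

section \<open>Bounded weak-star approximation of positive bidual elements\<close>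

text \<open>Strict separation of the point \<open>c\<close> from the image of \<open>S\<close> under \<open>x \<mapsto> (f i x)\<^sub>i\<close> in the Euclidean
  space indexed by \<open>F\<close>. The index set varies, so the space is not represented by a type.\<close>

lemma separation_finite_functionals:
  fixes f :: "'i \<Rightarrow> 'a::real_normed_vector \<Rightarrow>\<^sub>L real" and c :: "'i \<Rightarrow> real"
  assumes F: "finite F" and S: "convex S" "bounded S" "S \<noteq> {}"
    and e: "0 < e" and far: "\<And>x. x \<in> S \<Longrightarrow> e \<le> (\<Sum>i\<in>F. (c i - f i x)\<^sup>2)"
  obtains a \<alpha> where "\<And>x. x \<in> S \<Longrightarrow> (\<Sum>i\<in>F. a i * f i x) \<le> \<alpha>" "\<alpha> < (\<Sum>i\<in>F. a i * c i)"
proof -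
  define D where "D = (\<lambda>x. \<Sum>i\<in>F. (c i - f i x)\<^sup>2)"
  define d where "d = (INF x\<in>S. D x)"
  have bdd: "bdd_below (D ` S)"
    by (rule bdd_belowI2[of _ 0]) (auto simp: D_def intro: sum_nonneg)
  have d_le: "d \<le> D x" if "x \<in> S" for x unfolding d_def by (rule cINF_lower[OF bdd that])
  have "e \<le> d" unfolding d_def by (rule cINF_greatest[OF S(3)]) (use far in \<open>auto simp: D_def\<close>)
  with e have "0 < d" by simp
  obtain R where R: "\<And>x. x \<in> S \<Longrightarrow> norm x \<le> R" using S(2) bounded_iff by metis
  define M where "M = (\<Sum>i\<in>F. (norm (f i) * (2 * R))\<^sup>2) + 1"
  have "1 \<le> M" unfolding M_def by (simp add: sum_nonneg)
  have M: "(\<Sum>i\<in>F. (f i (x - y))\<^sup>2) \<le> M" if "x \<in> S" "y \<in> S" for x y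
  proof -
    have "norm (x - y) \<le> 2 * R" using norm_triangle_ineq4[of x y] R[OF that(1)] R[OF that(2)] by simp
    then have "\<bar>f i (x - y)\<bar> \<le> norm (f i) * (2 * R)" for i
      using norm_blinfun[of "f i" "x - y"]
      by (metis mult_left_mono norm_ge_zero order_trans real_norm_def)
    then have "(f i (x - y))\<^sup>2 \<le> (norm (f i) * (2 * R))\<^sup>2" for i
      by (metis abs_ge_zero power2_abs power_mono)
    then show ?thesis unfolding M_def by (smt (verit) sum_mono)
  qed
  \<comment> \<open>An almost nearest point stands in for a nearest one, which need not exist: if \<open>D x0\<close> is
    within \<open>t d / 4\<close> of the infimum \<open>d\<close>, then moving by the fraction \<open>t = min 1 (d / (4 M))\<close> towards
    \<open>x\<close> would lower \<open>D\<close> below \<open>d\<close> if the scalar product of \<open>a\<close> with the image of \<open>x - x0\<close>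
    exceeded \<open>d / 4\<close>, whereas the scalar product of \<open>a\<close> with itself is \<open>D x0 \<ge> d\<close>.\<close>
  define t where "t = min 1 (d / (4 * M))"
  have t: "0 < t" "t \<le> 1" "t * M \<le> d / 4"
    using \<open>0 < d\<close> \<open>1 \<le> M\<close> by (auto simp: t_def min_def field_simps)
  have "d < d + t * (d / 4)" using t \<open>0 < d\<close> by simp
  then obtain x0 where x0: "x0 \<in> S" "D x0 < d + t * (d / 4)"
    using cINF_less_iff[OF S(3) bdd] unfolding d_def[symmetric] by blast
  define a where "a = (\<lambda>i. c i - f i x0)"
  have Dx0: "D x0 = (\<Sum>i\<in>F. (a i)\<^sup>2)" by (simp add: D_def a_def)
  have step: "(\<Sum>i\<in>F. a i * f i (x - x0)) \<le> d / 4" if x: "x \<in> S" for x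
  proof -
    have "(1 - t) *\<^sub>R x0 + t *\<^sub>R x \<in> S"
      using S(1) x0(1) x t by (intro convexD) auto
    then have "d \<le> D ((1 - t) *\<^sub>R x0 + t *\<^sub>R x)" by (rule d_le)
    also have "\<dots> = (\<Sum>i\<in>F. (a i - t * f i (x - x0))\<^sup>2)"
      unfolding D_def a_def
      by (intro sum.cong arg_cong[where f = "\<lambda>u. u\<^sup>2"] refl)
        (simp add: blinfun.add_right blinfun.diff_right blinfun.scaleR_right algebra_simps)
    also have "\<dots> = D x0 - 2 * t * (\<Sum>i\<in>F. a i * f i (x - x0)) + t\<^sup>2 * (\<Sum>i\<in>F. (f i (x - x0))\<^sup>2)"
      unfolding Dx0 sum_distrib_left sum_subtractf[symmetric] sum.distrib[symmetric]
      by (intro sum.cong refl) (simp add: power2_eq_square algebra_simps)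
    finally have "2 * t * (\<Sum>i\<in>F. a i * f i (x - x0)) \<le> D x0 - d + t\<^sup>2 * (\<Sum>i\<in>F. (f i (x - x0))\<^sup>2)"
      by linarith
    also have "\<dots> \<le> t * (d / 4) + t\<^sup>2 * M"
      using x0(2) mult_left_mono[OF M[OF x x0(1)], of "t\<^sup>2"] by simp
    also have "\<dots> \<le> t * (d / 4) + t * (d / 4)"
      using mult_left_mono[OF t(3) less_imp_le[OF t(1)]] unfolding power2_eq_square mult.assoc
      by linarith
    also have "\<dots> = 2 * t * (d / 4)" by simp
    finally show ?thesis using t(1) by simp
  qed
  show ?thesis
  proof (rule that[of a "(\<Sum>i\<in>F. a i * f i x0) + d / 4"])
    show "(\<Sum>i\<in>F. a i * f i x) \<le> (\<Sum>i\<in>F. a i * f i x0) + d / 4" if "x \<in> S" for x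
      using step[OF that] by (simp add: blinfun.diff_right right_diff_distrib sum_subtractf)
    have "(\<Sum>i\<in>F. a i * c i) = (\<Sum>i\<in>F. a i * f i x0) + D x0"
      unfolding D_def a_def sum.distrib[symmetric]
      by (intro sum.cong refl) (simp add: power2_eq_square algebra_simps)
    then show "(\<Sum>i\<in>F. a i * f i x0) + d / 4 < (\<Sum>i\<in>F. a i * c i)"
      using d_le[OF x0(1)] \<open>0 < d\<close> by linarith
  qed
qed

text \<open>Goldstine's theorem for the positive part: the elements of \<open>K\<close> of norm at most \<open>norm \<phi>\<close> come
  weak-star arbitrarily close to \<open>\<phi>\<close>. The norm bound is what makes the approximating nets bounded.\<close>

lemma bidual_wedge_approximation:
  fixes K :: "'a::real_normed_vector set" and \<phi> :: "('a \<Rightarrow>\<^sub>L real) \<Rightarrow>\<^sub>L real"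
    and F :: "('a \<Rightarrow>\<^sub>L real) set"
  assumes K0: "0 \<in> K"
    and Kadd: "\<And>x y. x \<in> K \<Longrightarrow> y \<in> K \<Longrightarrow> x + y \<in> K"
    and Kscale: "\<And>x c. x \<in> K \<Longrightarrow> c \<ge> 0 \<Longrightarrow> c *\<^sub>R x \<in> K"
    and \<phi>: "\<phi> \<in> bidual_wedge K" and F: "finite F" and e: "0 < e"
  obtains x where "x \<in> K" "norm x \<le> norm \<phi>" "\<And>f. f \<in> F \<Longrightarrow> \<bar>blinfun_apply f x - \<phi> f\<bar> < e"
proof (cases "\<phi> = 0")
  case True
  with K0 e that[of 0] show ?thesis by (simp add: blinfun.zero_right)
next
  case False
  then have n: "0 < norm \<phi>" by simp
  define S where "S = {x\<in>K. norm x \<le> norm \<phi>}"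
  have "convex K"
    using Kadd Kscale by (auto simp: convex_def)
  moreover have "S = K \<inter> cball 0 (norm \<phi>)" by (auto simp: S_def)
  ultimately have S: "convex S" "bounded S"
    by (auto intro: convex_Int)
  have S0: "0 \<in> S" using K0 by (simp add: S_def)
  have "\<exists>x\<in>S. (\<Sum>f\<in>F. (\<phi> f - blinfun_apply f x)\<^sup>2) < e\<^sup>2"
  proof (rule ccontr)
    assume "\<not> ?thesis"
    then have "\<And>x. x \<in> S \<Longrightarrow> e\<^sup>2 \<le> (\<Sum>f\<in>F. (\<phi> f - blinfun_apply f x)\<^sup>2)" by (meson not_le)
    moreover have "S \<noteq> {}" "0 < e\<^sup>2" using S0 e by auto
    ultimately obtain a \<alpha> where a: "\<And>x. x \<in> S \<Longrightarrow> (\<Sum>f\<in>F. a f * blinfun_apply f x) \<le> \<alpha>"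
      and \<alpha>: "\<alpha> < (\<Sum>f\<in>F. a f * \<phi> f)"
      using separation_finite_functionals[where f = "\<lambda>f :: 'a \<Rightarrow>\<^sub>L real. f", OF F S] by blast
    define h where "h = (\<Sum>f\<in>F. a f *\<^sub>R f)"
    have hx: "h x = (\<Sum>f\<in>F. a f * blinfun_apply f x)" for x
      by (simp add: h_def blinfun.sum_left blinfun.scaleR_left)
    have \<phi>h: "\<phi> h = (\<Sum>f\<in>F. a f * \<phi> f)"
      by (simp add: h_def blinfun.sum_right blinfun.scaleR_right)
    have "0 \<le> \<alpha>" using a[OF S0] by (simp add: blinfun.zero_right)
    have hK: "h x \<le> \<alpha> / norm \<phi> * norm x" if "x \<in> K" for x
    proof (cases "x = 0")
      case False
      then have "(norm \<phi> / norm x) *\<^sub>R x \<in> S"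
        using that Kscale by (auto simp: S_def)
      then have "norm \<phi> / norm x * h x \<le> \<alpha>"
        using a hx by (metis blinfun.scaleR_right real_scaleR_def)
      then show ?thesis using False n by (simp add: field_simps)
    qed (simp add: blinfun.zero_right)
    have "0 \<le> \<alpha> / norm \<phi>" using \<open>0 \<le> \<alpha>\<close> by simp
    then obtain g where g: "norm g \<le> \<alpha> / norm \<phi>" "\<And>x. x \<in> K \<Longrightarrow> h x \<le> blinfun_apply g x"
      using dominated_on_cone_extension[OF K0 Kadd Kscale _ hK] by blast
    have "g - h \<in> dual_wedge K"
      using g(2) by (simp add: dual_wedge_def blinfun.diff_left)
    then have "\<phi> h \<le> \<phi> g"
      using \<phi> by (auto simp: bidual_wedge_def dual_wedge_def[of "dual_wedge K"] blinfun.diff_right)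
    also have "\<dots> \<le> norm \<phi> * norm g" using norm_blinfun[of \<phi> g] by simp
    also have "\<dots> \<le> \<alpha>" using g(1) n by (simp add: field_simps)
    finally show False using \<alpha> \<phi>h by simp
  qed
  then obtain x where x: "x \<in> S" "(\<Sum>f\<in>F. (\<phi> f - blinfun_apply f x)\<^sup>2) < e\<^sup>2" by blast
  show ?thesis
  proof
    fix f assume "f \<in> F"
    then have "(\<phi> f - blinfun_apply f x)\<^sup>2 < e\<^sup>2"
      using x(2) member_le_sum[OF \<open>f \<in> F\<close>, of "\<lambda>f. (\<phi> f - blinfun_apply f x)\<^sup>2"] F by auto
    then show "\<bar>blinfun_apply f x - \<phi> f\<bar> < e"
      using e by (metis abs_minus_commute power2_less_imp_less less_imp_le power2_abs)
  qed (use x in \<open>auto simp: S_def\<close>)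
qed

section \<open>Nets and their weak-star cluster points\<close>

lemma directed_preorder_nonempty: "directed_preorder J le \<Longrightarrow> J \<noteq> {}"
  by (simp add: directed_preorder_def)

lemma eventually_tail_filter:
  assumes "directed_preorder J le"
  shows "eventually P (tail_filter J le) \<longleftrightarrow> (\<exists>i\<in>J. \<forall>j\<in>J. le i j \<longrightarrow> P j)"
  unfolding tail_filter_def
proof (subst eventually_INF_base)
  show "J \<noteq> {}" using assms by (rule directed_preorder_nonempty)
  fix a b assume "a \<in> J" "b \<in> J"
  with assms obtain k where "k \<in> J" "le a k" "le b k"
    unfolding directed_preorder_def by blast
  with assms \<open>a \<in> J\<close> \<open>b \<in> J\<close>
  have "{j\<in>J. le k j} \<subseteq> {j\<in>J. le a j} \<inter> {j\<in>J. le b j}"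
    unfolding directed_preorder_def by blast
  with \<open>k \<in> J\<close> show "\<exists>x\<in>J. principal {j\<in>J. le x j}
      \<le> inf (principal {j\<in>J. le a j}) (principal {j\<in>J. le b j})"
    by auto
qed (auto simp: eventually_principal)

text \<open>Weak-star compactness of balls in the bidual, stated with filters: \<open>G\<close> refines \<open>F\<close> as a subnet
  would. Tychonoff's theorem gives the limit \<open>l\<close> as a function on the dual, and linearity and
  boundedness pass to it pointwise.\<close>

lemma bounded_weak_star_cluster:
  fixes x :: "'j \<Rightarrow> 'a::real_normed_vector"
  assumes F: "F \<noteq> bot" and bound: "eventually (\<lambda>j. norm (x j) \<le> M) F"
  obtains G and \<phi> :: "('a \<Rightarrow>\<^sub>L real) \<Rightarrow>\<^sub>L real"
  where "G \<noteq> bot" "G \<le> F" "\<And>f. ((\<lambda>j. blinfun_apply f (x j)) \<longlongrightarrow> \<phi> f) G"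
proof -
  define \<Phi> where "\<Phi> = (\<lambda>j (f :: 'a \<Rightarrow>\<^sub>L real). blinfun_apply f (x j))"
  define P where "P = (\<Pi>\<^sub>E f\<in>(UNIV :: ('a \<Rightarrow>\<^sub>L real) set). {- (norm f * M)..norm f * M})"
  have fM: "\<bar>f (x j)\<bar> \<le> norm f * M" if "norm (x j) \<le> M" for f :: "'a \<Rightarrow>\<^sub>L real" and j
    using norm_blinfun[of f "x j"] mult_left_mono[OF that, of "norm f"] by simp
  have "compact P"
  proof -
    have "compactin (product_topology (\<lambda>_. euclidean) UNIV) P"
      unfolding P_def by (subst compactin_PiE) (auto simp: compactin_euclidean_iff)
    then show ?thesis
      by (simp add: euclidean_product_topology compactin_euclidean_iff)
  qed
  moreover have "eventually (\<lambda>l. l \<in> P) (filtermap \<Phi> F)"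
    unfolding eventually_filtermap
    using bound by eventually_elim (use fM in \<open>auto simp: P_def \<Phi>_def abs_le_iff minus_le_iff\<close>)
  moreover have "filtermap \<Phi> F \<noteq> bot" using F by (simp add: filtermap_bot_iff)
  ultimately obtain l where l: "inf (nhds l) (filtermap \<Phi> F) \<noteq> bot"
    unfolding compact_filter by blast
  define G where "G = inf F (filtercomap \<Phi> (nhds l))"
  have G: "G \<noteq> bot"
  proof
    assume "G = bot"
    then have "eventually (\<lambda>_. False) G" by simp
    then obtain Q R where Q: "eventually Q F" and R: "eventually R (nhds l)"
      and QR: "\<And>j. Q j \<Longrightarrow> R (\<Phi> j) \<Longrightarrow> False"
      unfolding G_def eventually_inf eventually_filtercomap by metis
    have "eventually (\<lambda>v. \<not> R v) (filtermap \<Phi> F)"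
      unfolding eventually_filtermap using Q by eventually_elim (use QR in blast)
    with R have "eventually (\<lambda>_. False) (inf (nhds l) (filtermap \<Phi> F))"
      unfolding eventually_inf by blast
    with l show False by (simp add: trivial_limit_def)
  qed
  have GF: "G \<le> F" by (simp add: G_def)
  have "filterlim \<Phi> (nhds l) G"
    unfolding filterlim_iff_le_filtercomap by (simp add: G_def)
  then have lim: "((\<lambda>j. blinfun_apply f (x j)) \<longlongrightarrow> l f) G" for f
    using continuous_on_tendsto_compose[OF continuous_on_product_coordinates[of f], of \<Phi> l G]
    by (simp add: \<Phi>_def)
  have bl: "\<bar>l f\<bar> \<le> norm f * M" for f
  proof (rule tendsto_upperbound[OF tendsto_rabs[OF lim] _ G])
    show "eventually (\<lambda>j. \<bar>f (x j)\<bar> \<le> norm f * M) G"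
      using filter_leD[OF GF bound] by eventually_elim (rule fM)
  qed
  have "bounded_linear l"
  proof (rule bounded_linear_intro[where K = M])
    fix f g :: "'a \<Rightarrow>\<^sub>L real" and r :: real
    show "l (f + g) = l f + l g"
      using tendsto_unique[OF G lim[of "f + g"]] tendsto_add[OF lim[of f] lim[of g]]
      by (simp add: blinfun.add_left)
    show "l (r *\<^sub>R f) = r *\<^sub>R l f"
      using tendsto_unique[OF G lim[of "r *\<^sub>R f"]] tendsto_mult_left[OF lim[of f], of r]
      by (simp add: blinfun.scaleR_left)
  qed (use bl in auto)
  then have "blinfun_apply (Blinfun l) = l" by (rule bounded_linear_Blinfun_apply)
  with G GF lim show ?thesis by (intro that[of G "Blinfun l"]) simp_all
qed

section \<open>Pointedness of the bidual wedge and domination\<close>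

lemma pointed_bidual_wedge_iff:
  "pointed (bidual_wedge K) \<longleftrightarrow>
     (\<forall>\<phi>. \<phi> \<in> bidual_wedge K \<longrightarrow> - \<phi> \<in> bidual_wedge K \<longrightarrow> \<phi> = 0)"
proof -
  have "0 \<in> bidual_wedge K" by (simp add: bidual_wedge_def dual_wedge_def)
  moreover have "\<phi> \<in> uminus ` W \<longleftrightarrow> - \<phi> \<in> W" for \<phi> and W :: "(('a \<Rightarrow>\<^sub>L real) \<Rightarrow>\<^sub>L real) set"
    by force
  ultimately show ?thesis by (auto simp: pointed_def)
qed

lemma domination_if_pointed_bidual:
  fixes K :: "'a::real_normed_vector set"
  assumes pt: "pointed (bidual_wedge K)"
  shows "weak_null_domination TYPE('j) K"
  unfolding weak_null_domination_def
proof (intro allI impI)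
  fix J :: "'j set" and le and x y :: "'j \<Rightarrow> 'a"
  assume dir: "directed_preorder J le" and bx: "bounded (x ` J)"
    and dom: "\<forall>j\<in>J. cone_le K 0 (x j) \<and> cone_le K (x j) (y j)"
    and y: "weakly_tendsto y 0 (tail_filter J le)"
  let ?T = "tail_filter J le"
  have J: "eventually (\<lambda>j. j \<in> J) ?T"
    using directed_preorder_nonempty[OF dir] by (auto simp: eventually_tail_filter[OF dir])
  obtain M where M: "\<And>j. j \<in> J \<Longrightarrow> norm (x j) \<le> M" using bx by (auto simp: bounded_iff)
  have yf: "((\<lambda>j. f (y j)) \<longlongrightarrow> 0) ?T" for f :: "'a \<Rightarrow>\<^sub>L real"
    using y by (simp add: weakly_tendsto_def blinfun.zero_right)
  have "((\<lambda>j. f (x j)) \<longlongrightarrow> 0) ?T" for f :: "'a \<Rightarrow>\<^sub>L real"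
  proof (rule ccontr)
    assume "\<not> ?thesis"
    then obtain e where e: "0 < e" and freq: "\<not> eventually (\<lambda>j. \<bar>f (x j)\<bar> < e) ?T"
      by (auto simp: tendsto_iff)
    define F where "F = inf ?T (principal {j. e \<le> \<bar>f (x j)\<bar>})"
    have "F \<noteq> bot"
      using freq by (simp add: F_def trivial_limit_def eventually_inf_principal not_le)
    moreover have FT: "F \<le> ?T" by (simp add: F_def)
    then have FJ: "eventually (\<lambda>j. j \<in> J) F" using J by (rule filter_leD)
    then have "eventually (\<lambda>j. norm (x j) \<le> M) F" by eventually_elim (rule M)
    ultimately obtain G \<phi> where G: "G \<noteq> bot" "G \<le> F"
      and lim: "\<And>g :: 'a \<Rightarrow>\<^sub>L real. ((\<lambda>j. blinfun_apply g (x j)) \<longlongrightarrow> blinfun_apply \<phi> g) G"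
      using bounded_weak_star_cluster by metis
    have GJ: "eventually (\<lambda>j. j \<in> J) G" using G(2) FJ by (rule filter_leD)
    have "0 \<le> \<phi> g \<and> \<phi> g \<le> 0" if g: "g \<in> dual_wedge K" for g
    proof
      show "0 \<le> \<phi> g"
      proof (rule tendsto_lowerbound[OF lim _ G(1)])
        show "eventually (\<lambda>j. 0 \<le> g (x j)) G"
          using GJ by eventually_elim (use dom g in \<open>auto simp: cone_le_def dual_wedge_def\<close>)
      qed
      have "((\<lambda>j. g (y j)) \<longlongrightarrow> 0) G"
        using yf G(2) FT by (meson order_trans tendsto_mono)
      then show "\<phi> g \<le> 0"
      proof (rule tendsto_le[OF G(1) _ lim])
        show "eventually (\<lambda>j. g (x j) \<le> g (y j)) G"
          using GJ by eventually_elim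
            (use dom g in \<open>force simp: cone_le_def dual_wedge_def blinfun.diff_right\<close>)
      qed
    qed
    then have "\<phi> \<in> bidual_wedge K" "- \<phi> \<in> bidual_wedge K"
      by (auto simp: bidual_wedge_def dual_wedge_def[of "dual_wedge K"] blinfun.minus_left)
    then have "\<phi> = 0" using pt by (simp add: pointed_bidual_wedge_iff)
    moreover have "e \<le> \<bar>\<phi> f\<bar>"
    proof (rule tendsto_lowerbound[OF tendsto_rabs[OF lim] _ G(1)])
      have "eventually (\<lambda>j. e \<le> \<bar>f (x j)\<bar>) F" by (simp add: F_def eventually_inf_principal)
      then show "eventually (\<lambda>j. e \<le> \<bar>f (x j)\<bar>) G" by (rule filter_leD[OF G(2)])
    qed
    ultimately show False using e by simp
  qed
  then show "weakly_tendsto x 0 ?T" by (simp add: weakly_tendsto_def blinfun.zero_right)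
qed

lemma pointed_bidual_if_domination:
  fixes K :: "'a::real_normed_vector set"
  assumes K0: "0 \<in> K"
    and Kadd: "\<And>x y. x \<in> K \<Longrightarrow> y \<in> K \<Longrightarrow> x + y \<in> K"
    and Kscale: "\<And>x c. x \<in> K \<Longrightarrow> c \<ge> 0 \<Longrightarrow> c *\<^sub>R x \<in> K"
    and dom: "weak_null_domination TYPE('a pair_net_index) K"
  shows "pointed (bidual_wedge K)"
  unfolding pointed_bidual_wedge_iff
proof (intro allI impI)
  fix \<phi> assume \<phi>: "\<phi> \<in> bidual_wedge K" "- \<phi> \<in> bidual_wedge K"
  \<comment> \<open>\<open>N F e\<close> consists of the pairs that approximate \<open>(\<phi>, - \<phi>)\<close> on \<open>F\<close> up to \<open>e\<close>. The nets choose
    from these sets in all possible ways, so an index is a member \<open>w\<close> together with its set.\<close>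
  define N where "N F e = {(x, z). x \<in> K \<and> z \<in> K \<and> norm x \<le> norm \<phi> \<and> norm z \<le> norm \<phi> \<and>
    (\<forall>f\<in>F. \<bar>blinfun_apply f x - \<phi> f\<bar> < e \<and> \<bar>blinfun_apply f z + \<phi> f\<bar> < e)}" for F :: "('a \<Rightarrow>\<^sub>L real) set" and e :: real
  have N_ne: "\<exists>w. w \<in> N F e" if Fe: "finite F" "0 < e" for F e
  proof -
    obtain x where x: "x \<in> K" "norm x \<le> norm \<phi>" "\<And>f. f \<in> F \<Longrightarrow> \<bar>blinfun_apply f x - \<phi> f\<bar> < e"
      using bidual_wedge_approximation[OF K0 Kadd Kscale \<phi>(1) Fe] by metis
    obtain z where z: "z \<in> K" "norm z \<le> norm (- \<phi>)" "\<And>f. f \<in> F \<Longrightarrow> \<bar>blinfun_apply f z - (- \<phi>) f\<bar> < e"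
      using bidual_wedge_approximation[OF K0 Kadd Kscale \<phi>(2) Fe] by metis
    from x z have "(x, z) \<in> N F e" by (simp add: N_def blinfun.minus_left)
    then show ?thesis ..
  qed
  define J :: "'a pair_net_index set"
    where "J = {(w, A). w \<in> A \<and> (\<exists>F e. finite F \<and> 0 < e \<and> A = N F e)}"
  define le :: "'a pair_net_index \<Rightarrow> 'a pair_net_index \<Rightarrow> bool" where "le i j \<longleftrightarrow> snd j \<subseteq> snd i" for i j
  have JI: "\<exists>w. (w, N F e) \<in> J" if "finite F" "0 < e" for F e
    using N_ne[OF that] that by (auto simp: J_def)
  have dir: "directed_preorder J le"
    unfolding directed_preorder_def
  proof (intro conjI ballI)
    show "J \<noteq> {}" using JI[of "{}" 1] by auto
    fix i j assume "i \<in> J" "j \<in> J"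
    then obtain F e F' e' where i: "finite F" "0 < e" "snd i = N F e"
      and j: "finite F'" "0 < e'" "snd j = N F' e'"
      by (auto simp: J_def)
    then obtain w where "(w, N (F \<union> F') (min e e')) \<in> J" using JI[of "F \<union> F'" "min e e'"] by auto
    moreover have "N (F \<union> F') (min e e') \<subseteq> N F e \<inter> N F' e'" by (auto simp: N_def)
    ultimately show "\<exists>k\<in>J. le i k \<and> le j k"
      using i(3) j(3) by (intro bexI[of _ "(w, N (F \<union> F') (min e e'))"]) (auto simp: le_def)
  qed (auto simp: le_def)
  define x :: "'a pair_net_index \<Rightarrow> 'a" where "x j = fst (fst j)" for j
  define y :: "'a pair_net_index \<Rightarrow> 'a" where "y j = fst (fst j) + snd (fst j)" for j
  have props: "x j \<in> K" "y j - x j \<in> K" "norm (x j) \<le> norm \<phi>" "norm (y j - x j) \<le> norm \<phi>"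
    if "j \<in> J" for j
    using that by (auto simp: J_def N_def x_def y_def)
  have ev: "eventually (\<lambda>j. \<bar>blinfun_apply f (x j) - \<phi> f\<bar> < e \<and> \<bar>blinfun_apply f (y j - x j) + \<phi> f\<bar> < e) (tail_filter J le)"
    if "0 < e" for f e
  proof -
    obtain w where w: "(w, N {f} e) \<in> J" using JI[of "{f}" e] \<open>0 < e\<close> by auto
    have "fst j \<in> N {f} e" if "j \<in> J" "le (w, N {f} e) j" for j
      using that by (auto simp: J_def le_def)
    then show ?thesis
      unfolding eventually_tail_filter[OF dir]
      by (intro bexI[OF _ w]) (force simp: N_def x_def y_def)
  qed
  have x_lim: "((\<lambda>j. blinfun_apply f (x j)) \<longlongrightarrow> \<phi> f) (tail_filter J le)" for f
    unfolding tendsto_iff dist_real_def using ev[unfolded eventually_conj_iff] by simp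
  have z_lim: "((\<lambda>j. blinfun_apply f (y j - x j)) \<longlongrightarrow> - \<phi> f) (tail_filter J le)" for f
    unfolding tendsto_iff dist_real_def using ev[unfolded eventually_conj_iff] by simp
  have "((\<lambda>j. blinfun_apply f (y j)) \<longlongrightarrow> 0) (tail_filter J le)" for f :: "'a \<Rightarrow>\<^sub>L real"
    using tendsto_add[OF x_lim[of f] z_lim[of f]] by (simp add: blinfun.diff_right)
  then have y_null: "weakly_tendsto y 0 (tail_filter J le)"
    by (simp add: weakly_tendsto_def blinfun.zero_right)
  have bx: "bounded (x ` J)" using props(3) unfolding bounded_iff by blast
  have "norm (y j) \<le> norm \<phi> + norm \<phi>" if "j \<in> J" for j
    using norm_triangle_ineq[of "x j" "y j - x j"] props[OF that] by simp
  then have by': "bounded (y ` J)" unfolding bounded_iff by blast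
  have "weakly_tendsto x 0 (tail_filter J le)"
    using dom[unfolded weak_null_domination_def, rule_format, OF dir bx by' _ y_null] props(1,2)
    unfolding cone_le_def diff_zero by blast
  then have "((\<lambda>j. blinfun_apply f (x j)) \<longlongrightarrow> 0) (tail_filter J le)" for f :: "'a \<Rightarrow>\<^sub>L real"
    by (simp add: weakly_tendsto_def blinfun.zero_right)
  moreover have "tail_filter J le \<noteq> bot"
    unfolding trivial_limit_def eventually_tail_filter[OF dir]
    using dir unfolding directed_preorder_def by blast
  ultimately have "\<phi> f = 0" for f using x_lim[of f] tendsto_unique by blast
  then show "\<phi> = 0" by (intro blinfun_eqI) simp
qed

theorem proposition5p2:
  fixes K :: "'a::banach set"
  assumes "ordered_banach_cone K"
  shows "(pointed (bidual_wedge K) \<longleftrightarrow> weak_null_domination TYPE('a pair_net_index) K) \<and>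
         (pointed (bidual_wedge K) \<longrightarrow> weak_null_domination TYPE('j) K)"
proof -
  have comb: "\<alpha> *\<^sub>R x + \<beta> *\<^sub>R y \<in> K" if "0 \<le> \<alpha>" "0 \<le> \<beta>" "x \<in> K" "y \<in> K" for \<alpha> \<beta> x y
    using assms that by (simp add: ordered_banach_cone_def)
  obtain x where "x \<in> K" using assms by (auto simp: ordered_banach_cone_def)
  then have K0: "0 \<in> K" using comb[of 0 0 x x] by simp
  have Kadd: "x + y \<in> K" if "x \<in> K" "y \<in> K" for x y using comb[of 1 1 x y] that by simp
  have Kscale: "c *\<^sub>R x \<in> K" if "x \<in> K" "c \<ge> 0" for x c using comb[of c 0 x x] that by simp
  have "pointed (bidual_wedge K)" if "weak_null_domination TYPE('a pair_net_index) K"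
    using pointed_bidual_if_domination[OF K0 Kadd Kscale that] .
  then show ?thesis using domination_if_pointed_bidual[of K, where 'j = 'j]
      domination_if_pointed_bidual[of K, where 'j = "'a pair_net_index"] by blast
qed

end
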